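(* Let $\mathcal{H}$ be a separable Hilbert space and let $V$ be an elliptical random element in $\mathcal{H}$ with $E(V)=0$ and with a compact covariance operator $\Gamma_V$. Let $\{y_1,\ldots,y_k\}\subset\mathcal{H}$ be a set of $k>1$ self-consistent points for $V$, and let $\mathcal{W}$ be the linear subspace spanned by $y_1,\ldots,y_k$. Then $\mathcal{W}$ is spanned by a set of eigenfunctions (eigenvectors) of $\Gamma_V$.
   Context: All Hilbert spaces are real. Multivariate elliptical distribution: a random vector $X\in\mathbb{R}^d$ is elliptical, $X\sim\mathcal{E}_d(\mu,\Sigma)$, if there are $\mu\in\mathbb{R}^d$, a positive semidefinite $\Sigma\in\mathbb{R}^{d\times d}$ and a function $\phi:\mathbb{R}_+\to\mathbb{R}$ such that the characteristic function of $X-\mu$ is $t\mapsto\phi(t^{T}\Sigma t)$, $t\in\mathbb{R}^d$. Elliptical random element: a random element $V$ of a separable Hilbert space $\mathcal{H}$ is elliptical with parameters $\mu\in\mathcal{H}$ and $\Gamma:\mathcal{H}\to\mathcal{H}$ (self-adjoint, positive semidefinite, compact), written $V\sim\mathcal{E}(\mu,\Gamma)$, if for every $d$ and every bounded linear operator $A:\mathcal{H}\to\mathbb{R}^d$ one has $AV\sim\mathcal{E}_d(A\mu,A\Gamma A^* )$, where $A^*$ is the adjoint of $A$. $V$ is called elliptical if this holds for some $\mu,\Gamma$. Covariance operator: $\Gamma_V$ is defined by $\langle\Gamma_V u,v\rangle=\mathrm{Cov}(\langle u,V\rangle,\langle v,V\rangle)$ for $u,v\in\mathcal{H}$; its existence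 presupposes $E(\|V\|^2)<\infty$. Domains of attraction: for $y_1,\ldots,y_k\in\mathcal{H}$, the domain of attraction $\mathcal{D}_j$ of $y_j$ consists of all $x\in\mathcal{H}$ having $y_j$ as closest point among $y_1,\ldots,y_k$, i.e. $\|x-y_j\|<\|x-y_\ell\|$ for all $\ell\neq j$; a point whose minimal distance is attained by several $y_j$ is assigned to the domain with the lowest such index $j$. Self-consistency: $\{y_1,\ldots,y_k\}$ is self-consistent for $V$ if $E(V\mid V\in\mathcal{D}_j)=y_j$ for all $j=1,\ldots,k$ (expectation conditional on the event $\{V\in\mathcal{D}_j\}$, which is understood to have positive probability). *)

theory Defs
  imports "HOL-Probability.Probability"
begin

text \<open>
  A separable real Hilbert space is a type of sort
  \<open>{real_inner, banach, second_countable_topology}\<close>; for metric spaces, separability and second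
  countability agree.

  Since the dimension \<open>d\<close> is quantified inside the definition of an elliptical random element,
  a vector in \<open>\<real>\<^sup>d\<close> is a function \<open>nat \<Rightarrow> real\<close> and a \<open>d \<times> d\<close> matrix a function
  \<open>nat \<Rightarrow> nat \<Rightarrow> real\<close>, of which only the entries with indices below \<open>d\<close> matter.
\<close>

definition psd_matrix :: "nat \<Rightarrow> (nat \<Rightarrow> nat \<Rightarrow> real) \<Rightarrow> bool" where
  "psd_matrix d S \<longleftrightarrow>
     (\<forall>i<d. \<forall>j<d. S i j = S j i) \<and> (\<forall>t. 0 \<le> (\<Sum>i<d. \<Sum>j<d. t i * S i j * t j))"

definition elliptical_vec ::
  "'w measure \<Rightarrow> nat \<Rightarrow> ('w \<Rightarrow> nat \<Rightarrow> real) \<Rightarrow> (nat \<Rightarrow> real) \<Rightarrow> (nat \<Rightarrow> nat \<Rightarrow> real) \<Rightarrow> bool" where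
  "elliptical_vec M d X m S \<longleftrightarrow>
     (\<forall>i<d. (\<lambda>w. X w i) \<in> borel_measurable M) \<and>
     psd_matrix d S \<and>
     (\<exists>\<phi> :: real \<Rightarrow> real. \<forall>t :: nat \<Rightarrow> real.
        (CLINT w|M. iexp (\<Sum>i<d. t i * (X w i - m i)))
          = complex_of_real (\<phi> (\<Sum>i<d. \<Sum>j<d. t i * S i j * t j)))"

text \<open>An operator into \<open>\<real>\<^sup>d\<close> is bounded and linear iff all its coordinate functionals are.\<close>

definition bounded_linear_Rd :: "nat \<Rightarrow> ('h::real_normed_vector \<Rightarrow> nat \<Rightarrow> real) \<Rightarrow> bool" where
  "bounded_linear_Rd d A \<longleftrightarrow> (\<forall>i<d. bounded_linear (\<lambda>x. A x i))"

text \<open>The analogue of \<^const>\<open>adjoint\<close> for operators into \<open>\<real>\<^sup>d\<close>.\<close>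

definition adjoint_Rd ::
  "nat \<Rightarrow> ('h::real_inner \<Rightarrow> nat \<Rightarrow> real) \<Rightarrow> (nat \<Rightarrow> real) \<Rightarrow> 'h" where
  "adjoint_Rd d A = (SOME B. \<forall>x s. (\<Sum>i<d. A x i * s i) = x \<bullet> B s)"

lemma adjoint_Rd_unique:
  assumes "\<And>x s. (\<Sum>i<d. A x i * s i) = x \<bullet> B s"
  shows "adjoint_Rd d A = B"
  unfolding adjoint_Rd_def
proof (rule some_equality)
  fix C assume "\<forall>x s. (\<Sum>i<d. A x i * s i) = x \<bullet> C s"
  then have "x \<bullet> C s = x \<bullet> B s" for x s
    using assms by metis
  then show "C = B"
    by (metis ext vector_eq_ldot)
qed (use assms in blast)

text \<open>The matrix of \<open>A G A\<^sup>*\<close> with respect to the standard basis of \<open>\<real>\<^sup>d\<close>: entry \<open>(i, j)\<close> is the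
  \<open>i\<close>-th coordinate of the image of the \<open>j\<close>-th unit vector.\<close>

definition sandwich_matrix ::
  "nat \<Rightarrow> ('h::real_inner \<Rightarrow> nat \<Rightarrow> real) \<Rightarrow> ('h \<Rightarrow> 'h) \<Rightarrow> nat \<Rightarrow> nat \<Rightarrow> real" where
  "sandwich_matrix d A G i j = A (G (adjoint_Rd d A (\<lambda>l. if l = j then 1 else 0))) i"

definition compact_operator :: "('h::real_normed_vector \<Rightarrow> 'h) \<Rightarrow> bool" where
  "compact_operator T \<longleftrightarrow> bounded_linear T \<and> compact (closure (T ` cball 0 1))"

definition self_adjoint :: "('h::real_inner \<Rightarrow> 'h) \<Rightarrow> bool" where
  "self_adjoint T \<longleftrightarrow> (\<forall>u v. T u \<bullet> v = u \<bullet> T v)"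

definition psd_operator :: "('h::real_inner \<Rightarrow> 'h) \<Rightarrow> bool" where
  "psd_operator T \<longleftrightarrow> (\<forall>u. 0 \<le> T u \<bullet> u)"

definition elliptical_with ::
  "'w measure \<Rightarrow> ('w \<Rightarrow> 'h::{real_inner, banach, second_countable_topology})
     \<Rightarrow> 'h \<Rightarrow> ('h \<Rightarrow> 'h) \<Rightarrow> bool" where
  "elliptical_with M V m G \<longleftrightarrow>
     V \<in> borel_measurable M \<and>
     self_adjoint G \<and> psd_operator G \<and> compact_operator G \<and>
     (\<forall>d A. bounded_linear_Rd d A \<longrightarrow>
        elliptical_vec M d (\<lambda>w. A (V w)) (A m) (sandwich_matrix d A G))"

definition elliptical ::
  "'w measure \<Rightarrow> ('w \<Rightarrow> 'h::{real_inner, banach, second_countable_topology}) \<Rightarrow> bool" where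
  "elliptical M V \<longleftrightarrow> (\<exists>m G. elliptical_with M V m G)"

definition covariance :: "'w measure \<Rightarrow> ('w \<Rightarrow> real) \<Rightarrow> ('w \<Rightarrow> real) \<Rightarrow> real" where
  "covariance M X Y =
     integral\<^sup>L M (\<lambda>w. (X w - integral\<^sup>L M X) * (Y w - integral\<^sup>L M Y))"

text \<open>The covariance operator is given as a predicate; the inner-product identity determines
  \<open>G\<close> uniquely (and forces it to be linear).\<close>

definition is_covariance_operator ::
  "'w measure \<Rightarrow> ('w \<Rightarrow> 'h::{real_inner, banach, second_countable_topology})
     \<Rightarrow> ('h \<Rightarrow> 'h) \<Rightarrow> bool" where
  "is_covariance_operator M V G \<longleftrightarrow>
     integrable M (\<lambda>w. (norm (V w))\<^sup>2) \<and>
     (\<forall>u v. G u \<bullet> v = covariance M (\<lambda>w. u \<bullet> V w) (\<lambda>w. v \<bullet> V w))"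

text \<open>Points are indexed by \<open>{1..k}\<close>; ties go to the lowest index.\<close>

definition attraction_domain ::
  "nat \<Rightarrow> (nat \<Rightarrow> 'h::real_normed_vector) \<Rightarrow> nat \<Rightarrow> 'h set" where
  "attraction_domain k y j =
     {x. \<forall>l\<in>{1..k}. norm (x - y j) \<le> norm (x - y l) \<and>
                    (l < j \<longrightarrow> norm (x - y j) < norm (x - y l))}"

text \<open>\<^const>\<open>uniform_measure\<close> \<open>M E\<close> is \<open>M\<close> conditioned on the event \<open>E\<close>.\<close>

definition self_consistent ::
  "'w measure \<Rightarrow> ('w \<Rightarrow> 'h::{real_inner, banach, second_countable_topology})
     \<Rightarrow> nat \<Rightarrow> (nat \<Rightarrow> 'h) \<Rightarrow> bool" where
  "self_consistent M V k y \<longleftrightarrow>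
     (\<forall>j\<in>{1..k}.
        let E = {w \<in> space M. V w \<in> attraction_domain k y j} in
        measure M E > 0 \<and> integral\<^sup>L (uniform_measure M E) V = y j)"

definition eigenvector :: "('h::real_vector \<Rightarrow> 'h) \<Rightarrow> 'h \<Rightarrow> bool" where
  "eigenvector T v \<longleftrightarrow> v \<noteq> 0 \<and> (\<exists>c. T v = c *\<^sub>R v)"

end

theory Submission
  imports Defs
begin

text \<open>
  Let \<open>G\<close> be the operator of the elliptical law and \<open>W = span {y\<^sub>1, \<dots>, y\<^sub>k}\<close>. If \<open>u\<close> is orthogonal to
  \<open>G W\<close>, the joint characteristic function of \<open>\<langle>u, V\<rangle>\<close> and \<open>\<langle>w, V\<rangle>\<close>, \<open>w \<in> W\<close>, is even in the first
  argument, so \<open>E (\<langle>u, V\<rangle> exp (\<i>\<langle>w, V\<rangle>)) = 0\<close>. Each domain of attraction is cut out by half-spaces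
  with normals in \<open>W\<close>, so Fourier uniqueness gives \<open>E (\<langle>u, V\<rangle> | V \<in> D\<^sub>j) = 0\<close>, that is
  \<open>\<langle>u, y\<^sub>j\<rangle> = 0\<close>. Hence \<open>W \<subseteq> G W\<close>, and comparing dimensions \<open>G W = W\<close>. The spectral theorem on the
  finite-dimensional space \<open>W\<close> yields spanning eigenvectors of \<open>G\<close>, and the covariance operator is a
  multiple of \<open>G\<close>.
\<close>

subsection \<open>Self-adjoint operators on finite-dimensional invariant subspaces\<close>

text \<open>Orthogonal projection onto a finite-dimensional subspace of a space of any dimension:
  Gram-Schmidt gives an orthogonal spanning set, and \<open>p\<close> is the Fourier expansion of
  \<open>x\<close> in it.\<close>

lemma span_finite_orthogonal_decomp:
  fixes B :: "'a::real_inner set"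
  assumes "finite B"
  obtains p r where "p \<in> span B" "\<And>v. v \<in> span B \<Longrightarrow> r \<bullet> v = 0" "x = p + r"
proof -
  obtain C where C: "finite C" "span C = span B" "pairwise orthogonal C"
    using basis_orthogonal[OF assms] by blast
  \<comment> \<open>A zero vector in \<open>C\<close> does no harm: its coefficient is
    \<open>0 / 0 = 0\<close>.\<close>
  define p where "p = (\<Sum>b\<in>C. (b \<bullet> x / (b \<bullet> b)) *\<^sub>R b)"
  have perp: "(x - p) \<bullet> c = 0" if "c \<in> C" for c
  proof -
    have "p \<bullet> c = (\<Sum>b\<in>C. if b = c then c \<bullet> x else 0)"
      unfolding p_def inner_sum_left
      using C(3) that by (intro sum.cong) (auto simp: pairwise_def orthogonal_def)
    then show ?thesis
      using C(1) that by (simp add: inner_diff_left inner_commute[of x c])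
  qed
  have "(x - p) \<bullet> v = 0" if "v \<in> span C" for v
    using that by (induction rule: span_induct) (auto simp: subspace_def inner_add_right perp)
  moreover have "p \<in> span C"
    unfolding p_def by (intro span_sum span_scale span_base)
  ultimately show thesis
    using that[of p "x - p"] C(2) by simp
qed

text \<open>The unit sphere of the ambient space need not be compact, so compactness comes from
  coordinates. Relative to normalised orthogonal vectors, unit vectors of the span have coordinates
  in \<open>{-1..1}\<close>, and the set \<open>K C\<close> of all such combinations is compact by
  induction on \<open>C\<close>.\<close>

lemma compact_sphere_Int_span:
  fixes B :: "'a::real_inner set"
  assumes "finite B"
  shows "compact (sphere 0 1 \<inter> span B)"
proof -
  obtain C where C: "finite C" "span C = span B" "pairwise orthogonal C"
    using basis_orthogonal[OF assms] by blast
  define K where "K D = {\<Sum>b\<in>D. (t b / norm b) *\<^sub>R b | t. \<forall>b\<in>D. t b \<in> {-1..1}}" for D :: "'a set"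
  have compK: "compact (K D)" if "finite D" for D
    using that
  proof (induction D rule: finite_induct)
    case empty
    then show ?case by (simp add: K_def)
  next
    case (insert a D)
    have "K (insert a D) = (\<lambda>(s, v). (s / norm a) *\<^sub>R a + v) ` ({-1..1} \<times> K D)" (is "?L = ?R")
    proof (intro equalityI subsetI)
      fix x assume "x \<in> ?L"
      then obtain t where "x = (\<Sum>b\<in>insert a D. (t b / norm b) *\<^sub>R b)"
        "\<forall>b\<in>insert a D. t b \<in> {-1..1}"
        unfolding K_def by blast
      then have "x = (\<lambda>(s, v). (s / norm a) *\<^sub>R a + v) (t a, \<Sum>b\<in>D. (t b / norm b) *\<^sub>R b)"
        "(t a, \<Sum>b\<in>D. (t b / norm b) *\<^sub>R b) \<in> {-1..1} \<times> K D"
        using insert.hyps unfolding K_def by auto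
      then show "x \<in> ?R" by blast
    next
      fix x assume "x \<in> ?R"
      then obtain s t where st: "s \<in> {-1..1}" "\<forall>b\<in>D. t b \<in> {-1..1}"
        "x = (s / norm a) *\<^sub>R a + (\<Sum>b\<in>D. (t b / norm b) *\<^sub>R b)"
        unfolding K_def by auto
      have "(\<Sum>b\<in>D. (t b / norm b) *\<^sub>R b) = (\<Sum>b\<in>D. ((t(a := s)) b / norm b) *\<^sub>R b)"
        using insert.hyps by (intro sum.cong) auto
      then have "x = (\<Sum>b\<in>insert a D. ((t(a := s)) b / norm b) *\<^sub>R b)"
        using insert.hyps st(3) by simp
      moreover have "\<forall>b\<in>insert a D. (t(a := s)) b \<in> {-1..1}"
        using st by simp
      ultimately show "x \<in> ?L"
        unfolding K_def by blast
    qed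
    moreover have "continuous_on ({-1..1} \<times> K D) (\<lambda>(s, v). (s / norm a) *\<^sub>R a + v)"
      unfolding case_prod_beta by (cases "a = 0") (auto intro!: continuous_intros)
    ultimately show ?case
      using insert.IH by (auto intro!: compact_continuous_image compact_Times)
  qed
  have "sphere 0 1 \<inter> span C = sphere 0 1 \<inter> K C"
  proof (intro equalityI subsetI)
    fix x assume x: "x \<in> sphere 0 1 \<inter> span C"
    define t where "t b = (b \<bullet> x) / norm b" for b
    define z where "z = (\<Sum>b\<in>C. (t b / norm b) *\<^sub>R b)"
    have "t b \<in> {-1..1}" for b
      using Cauchy_Schwarz_ineq2[of b x] x
      by (cases "b = 0") (auto simp: t_def field_simps abs_le_iff)
    then have "z \<in> K C"
      unfolding z_def K_def by blast
    \<comment> \<open>The residual \<open>x - z\<close> is orthogonal to the span and also lies in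
      it, so it vanishes.\<close>
    have perp: "(x - z) \<bullet> c = 0" if "c \<in> C" for c
    proof -
      have "z \<bullet> c = (\<Sum>b\<in>C. if b = c then c \<bullet> x else 0)"
        unfolding z_def inner_sum_left
        using C(3) that
        by (intro sum.cong) (auto simp: t_def pairwise_def orthogonal_def dot_square_norm power2_eq_square)
      then show ?thesis
        using C(1) that by (simp add: inner_diff_left inner_commute[of x c])
    qed
    have "(x - z) \<bullet> v = 0" if "v \<in> span C" for v
      using that by (induction rule: span_induct) (auto simp: subspace_def inner_add_right perp)
    moreover have "z \<in> span C"
      unfolding z_def by (intro span_sum span_scale span_base)
    then have "x - z \<in> span C"
      using x by (simp add: span_diff)
    ultimately have "x = z"
      by (metis inner_eq_zero_iff eq_iff_diff_eq_0)
    then show "x \<in> sphere 0 1 \<inter> K C"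
      using x \<open>z \<in> K C\<close> by simp
  next
    fix x assume "x \<in> sphere 0 1 \<inter> K C"
    moreover from this obtain t where "x = (\<Sum>b\<in>C. (t b / norm b) *\<^sub>R b)"
      unfolding K_def by blast
    then have "x \<in> span C"
      by (auto intro: span_sum span_scale span_base)
    ultimately show "x \<in> sphere 0 1 \<inter> span C"
      by blast
  qed
  moreover have "compact (sphere 0 1 \<inter> K C)"
  proof -
    have "closed {x::'a. norm x = 1}"
      by (intro closed_Collect_eq continuous_intros)
    then have "closed (sphere (0::'a) 1)"
      by (simp add: sphere_def)
    from compact_Int_closed[OF compK[OF C(1)] this] show ?thesis
      by (simp only: Int_commute)
  qed
  ultimately show ?thesis
    using C(2) by simp
qed

text \<open>First-order condition at a maximum: for small \<open>s\<close> with the sign of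
  \<open>a\<close>, a nonzero linear term would exceed the quadratic one.\<close>

lemma linear_le_quadratic_imp_zero:
  fixes a b :: real
  assumes "\<And>s. s * a \<le> s\<^sup>2 * b"
  shows "a = 0"
proof (rule ccontr)
  assume "a \<noteq> 0"
  define c where "c = \<bar>b\<bar> + 1"
  have c: "c > 0" "b < c" by (auto simp: c_def)
  have "(a / c) * a \<le> (a / c)\<^sup>2 * b" by (rule assms)
  then have "a\<^sup>2 * c \<le> a\<^sup>2 * b"
    using c by (simp add: field_simps power2_eq_square)
  then show False
    using c \<open>a \<noteq> 0\<close> by simp
qed

text \<open>The eigenvector is a maximiser of the quadratic form on the unit sphere of \<open>U\<close>.\<close>

lemma self_adjoint_has_eigenvector:
  fixes T :: "'a::real_inner \<Rightarrow> 'a"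
  assumes T: "bounded_linear T" "self_adjoint T"
    and U: "subspace U" "compact (sphere 0 1 \<inter> U)" "T ` U \<subseteq> U" "U \<noteq> {0}"
  shows "\<exists>v\<in>U. eigenvector T v"
proof -
  interpret T: bounded_linear T by fact
  obtain u where u: "u \<in> U" "u \<noteq> 0"
    using U(1,4) subspace_0 by blast
  then have "sphere 0 1 \<inter> U \<noteq> {}"
    using U(1) subspace_scale[of U u "1 / norm u"]
    by (auto intro!: exI[of _ "(1 / norm u) *\<^sub>R u"] simp: disjoint_iff)
  then have "\<exists>x\<in>sphere 0 1 \<inter> U. \<forall>y\<in>sphere 0 1 \<inter> U. T y \<bullet> y \<le> T x \<bullet> x"
    using U(2) by (intro continuous_attains_sup) (auto intro!: continuous_intros T.continuous_on)
  then obtain x where x: "norm x = 1" "x \<in> U"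
    and max: "\<And>y. y \<in> U \<Longrightarrow> norm y = 1 \<Longrightarrow> T y \<bullet> y \<le> T x \<bullet> x"
    by auto
  define l where "l = T x \<bullet> x"
  have xx: "x \<bullet> x = 1"
    using x(1) by (simp add: dot_square_norm)
  have max': "T y \<bullet> y \<le> l * (y \<bullet> y)" if "y \<in> U" for y
  proof (cases "y = 0")
    case False
    have "T ((1 / norm y) *\<^sub>R y) \<bullet> ((1 / norm y) *\<^sub>R y) \<le> l"
      unfolding l_def using False that U(1) by (intro max) (auto simp: subspace_scale)
    then show ?thesis
      using False by (simp add: T.scaleR dot_square_norm field_simps power2_eq_square)
  qed (simp add: T.zero)
  \<comment> \<open>Moving from \<open>x\<close> to \<open>x + s *\<^sub>R y\<close> respects the
    bound \<open>max'\<close>. The terms of order zero cancel, which leaves a linear term in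
    \<open>s\<close> bounded by a quadratic one.\<close>
  have *: "T x \<bullet> y = 0" if y: "y \<in> U" "x \<bullet> y = 0" for y
  proof -
    have "s * (2 * (T x \<bullet> y)) \<le> s\<^sup>2 * (l * (y \<bullet> y) - T y \<bullet> y)" for s
    proof -
      have "T (x + s *\<^sub>R y) \<bullet> (x + s *\<^sub>R y) \<le> l * ((x + s *\<^sub>R y) \<bullet> (x + s *\<^sub>R y))"
        using U(1) x y by (intro max') (simp add: subspace_add subspace_scale)
      moreover have "T y \<bullet> x = T x \<bullet> y"
        using T(2) unfolding self_adjoint_def by (metis inner_commute)
      ultimately show ?thesis
        using y(2) by (simp add: T.add T.scaleR inner_add inner_commute[of y x] xx l_def[symmetric]
            algebra_simps power2_eq_square)
    qed
    then show ?thesis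
      using linear_le_quadratic_imp_zero by fastforce
  qed
  \<comment> \<open>The residual is itself an admissible direction for \<open>*\<close>, and
    \<open>y \<bullet> y = T x \<bullet> y - l * (x \<bullet> y)\<close>, where both terms
    vanish.\<close>
  define y where "y = T x - l *\<^sub>R x"
  have y: "y \<in> U" "x \<bullet> y = 0"
    using U(1,3) x xx by (auto simp: y_def l_def subspace_diff subspace_scale inner_diff_right inner_commute)
  then have "y \<bullet> y = 0"
    using *[OF y] by (subst (1) y_def) (simp add: inner_diff_left)
  then have "T x = l *\<^sub>R x"
    by (simp add: y_def)
  then show ?thesis
    using x unfolding eigenvector_def by (metis norm_zero zero_neq_one)
qed

text \<open>By self-adjointness, the vectors of \<open>span B\<close> orthogonal to all its
  eigenvectors form an invariant subspace \<open>U\<close>. If \<open>U\<close> were nonzero it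
  would contain an eigenvector, which would be orthogonal to itself.\<close>

lemma span_eigenvectors_eq_invariant_span:
  fixes T :: "'a::real_inner \<Rightarrow> 'a"
  assumes T: "bounded_linear T" "self_adjoint T"
    and B: "finite B" "T ` span B \<subseteq> span B"
  shows "span {v \<in> span B. eigenvector T v} = span B"
proof
  let ?E = "{v \<in> span B. eigenvector T v}"
  show "span ?E \<subseteq> span B"
    by (intro span_minimal) auto
  interpret T: bounded_linear T by fact
  define U where "U = {x \<in> span B. \<forall>v\<in>?E. x \<bullet> v = 0}"
  have U_eq: "U = span B \<inter> (\<Inter>v\<in>?E. {x. x \<bullet> v = 0})"
    unfolding U_def by blast
  have "subspace U"
    by (auto simp: U_def subspace_def inner_add_left span_add span_scale span_zero)
  moreover have "T ` U \<subseteq> U"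
  proof safe
    fix x assume x: "x \<in> U"
    have "T x \<bullet> v = 0" if v: "v \<in> ?E" for v
    proof -
      obtain c where "T v = c *\<^sub>R v"
        using v unfolding eigenvector_def by blast
      then have "T x \<bullet> v = c * (x \<bullet> v)"
        using T(2) unfolding self_adjoint_def by simp
      then show ?thesis
        using x v by (simp add: U_def)
    qed
    then show "T x \<in> U"
      using x B(2) unfolding U_def by blast
  qed
  moreover have "compact (sphere 0 1 \<inter> U)"
  proof -
    have "closed (\<Inter>v\<in>?E. {x. x \<bullet> v = 0})"
      by (intro closed_INT ballI closed_Collect_eq continuous_intros)
    then have "compact ((sphere 0 1 \<inter> span B) \<inter> (\<Inter>v\<in>?E. {x. x \<bullet> v = 0}))"
      by (intro compact_Int_closed compact_sphere_Int_span B)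
    then show ?thesis
      unfolding U_eq by (simp only: Int_assoc)
  qed
  moreover have "\<not> (\<exists>v\<in>U. eigenvector T v)"
    unfolding U_def eigenvector_def by fastforce
  ultimately have U0: "U = {0}"
    using self_adjoint_has_eigenvector[OF T] by blast
  \<comment> \<open>The projection needs a finite spanning set, whereas the eigenvectors may be
    infinite in number; independence inside \<open>span B\<close> makes \<open>C\<close>
    finite.\<close>
  obtain C where C: "C \<subseteq> ?E" "independent C" "?E \<subseteq> span C"
    using maximal_independent_subset[of ?E] by blast
  have "finite C"
    using independent_span_bound[OF B(1) C(2)] C(1) by blast
  show "span B \<subseteq> span ?E"
  proof
    fix x assume x: "x \<in> span B"
    obtain p r where pr: "p \<in> span C" "\<And>v. v \<in> span C \<Longrightarrow> r \<bullet> v = 0" "x = p + r"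
      using span_finite_orthogonal_decomp[OF \<open>finite C\<close>] by metis
    have p: "p \<in> span ?E"
      using pr(1) C(1) span_mono by blast
    then have "r \<in> span B"
      using \<open>span ?E \<subseteq> span B\<close> pr(3) x by (metis add_diff_cancel_left' span_diff subsetD)
    then have "r \<in> U"
      using pr(2) C(3) unfolding U_def by blast
    then show "x \<in> span ?E"
      using U0 p pr(3) by simp
  qed
qed

text \<open>The hypothesis forces \<open>Y\<close> into the image of \<open>span Y\<close> under
  \<open>T\<close>. That image has at most the dimension of \<open>span Y\<close>, so the two
  subspaces coincide.\<close>

lemma image_span_subset_if_orthogonal_complement:
  fixes T :: "'a::real_inner \<Rightarrow> 'a"
  assumes T: "linear T" and Y: "finite Y"
    and orth: "\<And>u. (\<And>w. w \<in> span Y \<Longrightarrow> u \<bullet> T w = 0) \<Longrightarrow> (\<And>w. w \<in> Y \<Longrightarrow> u \<bullet> w = 0)"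
  shows "T ` span Y \<subseteq> span Y"
proof -
  obtain B where B: "B \<subseteq> Y" "independent B" "Y \<subseteq> span B"
    using maximal_independent_subset[of Y] by blast
  have "finite B"
    using B(1) Y finite_subset by blast
  have span: "span B = span Y"
    using B by (metis span_eq span_superset subset_trans)
  have TB: "span (T ` B) = T ` span Y"
    using T by (metis linear_span_image span)
  have "Y \<subseteq> span (T ` B)"
  proof
    fix w assume w: "w \<in> Y"
    obtain p r where pr: "p \<in> span (T ` B)" "\<And>v. v \<in> span (T ` B) \<Longrightarrow> r \<bullet> v = 0" "w = p + r"
      using span_finite_orthogonal_decomp[of "T ` B" w] \<open>finite B\<close> by (metis finite_imageI)
    \<comment> \<open>The residual \<open>r\<close> is orthogonal to the image, hence to
      \<open>w = p + r\<close>; as it is also orthogonal to \<open>p\<close>, it is zero.\<close>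
    have "r \<bullet> w = 0"
      using orth[of r w] pr(2) w TB by blast
    then have "r \<bullet> r = 0"
      using pr(2)[OF pr(1)] pr(3) by (simp add: inner_add_right)
    then show "w \<in> span (T ` B)"
      using pr by simp
  qed
  then have YB: "B \<subseteq> span (T ` B)"
    using B(1) by blast
  \<comment> \<open>Otherwise \<open>card B + 1\<close> independent vectors would lie in a space
    spanned by at most \<open>card B\<close>.\<close>
  have "T b \<in> span B" if "b \<in> B" for b
  proof (rule ccontr)
    assume *: "T b \<notin> span B"
    then have "independent (insert (T b) B)"
      using B(2) by (simp add: independent_insert)
    moreover have "insert (T b) B \<subseteq> span (T ` B)"
      using YB that by (auto intro: span_base)
    ultimately have "card (insert (T b) B) \<le> card (T ` B)"
      using independent_span_bound[of "T ` B"] \<open>finite B\<close> by blast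
    then show False
      using * \<open>finite B\<close> card_image_le[of B T] span_base[of "T b" B] by fastforce
  qed
  then have "span (T ` B) \<subseteq> span B"
    by (intro span_minimal) auto
  then show ?thesis
    using TB span by simp
qed

subsection \<open>Moments and Fourier uniqueness\<close>

text \<open>A bounded substitute for \<open>x\<close>, built from sines so that characteristic
  functions determine its integrals.\<close>

lemma scaled_sin_tendsto: "(\<lambda>n. real (Suc n) * sin (x / real (Suc n))) \<longlonglongrightarrow> x"
proof (cases "x = 0")
  case False
  have "((\<lambda>h. sin h / h) \<longlongrightarrow> 1) (at (0::real))"
    using DERIV_sin[of 0] by (simp add: has_field_derivative_iff)
  moreover have "filterlim (\<lambda>n. x / real (Suc n)) (at 0) sequentially"
    using False by (auto simp: filterlim_at simp del: of_nat_Suc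
        intro!: real_tendsto_divide_at_top filterlim_compose[OF filterlim_real_sequentially filterlim_Suc])
  ultimately have "(\<lambda>n. sin (x / real (Suc n)) / (x / real (Suc n))) \<longlonglongrightarrow> 1"
    by (rule filterlim_compose)
  then have "(\<lambda>n. x * (sin (x / real (Suc n)) / (x / real (Suc n)))) \<longlonglongrightarrow> x * 1"
    by (rule tendsto_mult_left)
  then show ?thesis
    using False by (simp add: mult.commute)
qed simp

lemma abs_scaled_sin_le: "\<bar>real (Suc n) * sin (x / real (Suc n))\<bar> \<le> \<bar>x\<bar>"
proof -
  have "real (Suc n) * \<bar>sin (x / real (Suc n))\<bar> \<le> real (Suc n) * \<bar>x / real (Suc n)\<bar>"
    by (intro mult_left_mono abs_sin_x_le_abs_x) auto
  then show ?thesis by (simp add: abs_mult)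
qed

text \<open>Dominated convergence with \<open>\<bar>X w\<bar>\<close> as majorant replaces
  differentiation of the Fourier transform at zero.\<close>

lemma integral_mult_eq_zero_if_sin:
  fixes X :: "'w \<Rightarrow> real" and Z :: "'w \<Rightarrow> complex"
  assumes X: "integrable M X" and Z: "Z \<in> borel_measurable M" "\<And>w. norm (Z w) \<le> 1"
    and eq: "\<And>s. (CLINT w|M. Z w * complex_of_real (sin (s * X w))) = 0"
  shows "(CLINT w|M. Z w * X w) = 0"
proof -
  have [measurable]: "X \<in> borel_measurable M" "Z \<in> borel_measurable M"
    using X Z by auto
  have "(\<lambda>n. CLINT w|M. Z w * of_real (real (Suc n) * sin (X w / real (Suc n))))
      \<longlonglongrightarrow> (CLINT w|M. Z w * X w)"
  proof (rule integral_dominated_convergence[where w = "\<lambda>w. \<bar>X w\<bar>"])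
    show "AE w in M. norm (Z w * of_real (real (Suc n) * sin (X w / real (Suc n)))) \<le> \<bar>X w\<bar>" for n
      using mult_mono[OF Z(2) abs_scaled_sin_le]
      by (intro always_eventually allI) (simp only: norm_mult norm_of_real, fastforce)
    show "AE w in M. (\<lambda>n. Z w * of_real (real (Suc n) * sin (X w / real (Suc n)))) \<longlonglongrightarrow> Z w * X w"
      by (intro always_eventually allI tendsto_mult_left tendsto_of_real scaled_sin_tendsto)
  qed (use X in auto)
  moreover have "(CLINT w|M. Z w * of_real (real (Suc n) * sin (X w / real (Suc n)))) = 0" for n
  proof -
    have "(CLINT w|M. Z w * of_real (real (Suc n) * sin (X w / real (Suc n))))
        = (CLINT w|M. of_nat (Suc n) * (Z w * complex_of_real (sin (1 / real (Suc n) * X w))))"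
      by (intro Bochner_Integration.integral_cong) (auto simp: mult_ac)
    also have "\<dots> = of_nat (Suc n) * (CLINT w|M. Z w * complex_of_real (sin (1 / real (Suc n) * X w)))"
      by (rule integral_mult_right_zero)
    finally show ?thesis
      using eq[of "1 / real (Suc n)"] by (simp only: mult_zero_right)
  qed
  ultimately show ?thesis
    by (simp add: LIMSEQ_const_iff)
qed

text \<open>The second moment is recovered from the characteristic function through
  \<open>(n sin (X / n))\<^sup>2 = n\<^sup>2 / 2 \<cdot> (1 - cos (2 X / n)) \<longlonglongrightarrow> X\<^sup>2\<close>.\<close>

lemma second_moment_eq_if_cos:
  fixes X Y :: "'w \<Rightarrow> real"
  assumes X: "X \<in> borel_measurable M" "integrable M (\<lambda>w. (X w)\<^sup>2)"
    and Y: "Y \<in> borel_measurable M" "integrable M (\<lambda>w. (Y w)\<^sup>2)"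
    and M: "finite_measure M"
    and eq: "\<And>s. (LINT w|M. cos (s * X w)) = (LINT w|M. cos (s * Y w))"
  shows "(LINT w|M. (X w)\<^sup>2) = (LINT w|M. (Y w)\<^sup>2)"
proof -
  interpret finite_measure M by fact
  have lim: "(\<lambda>n. LINT w|M. (real (Suc n) * sin (X w / real (Suc n)))\<^sup>2) \<longlonglongrightarrow> (LINT w|M. (X w)\<^sup>2)"
    if X: "X \<in> borel_measurable M" "integrable M (\<lambda>w. (X w)\<^sup>2)" for X
  proof (rule integral_dominated_convergence[where w = "\<lambda>w. (X w)\<^sup>2"])
    note X(1)[measurable]
    show "AE w in M. norm ((real (Suc n) * sin (X w / real (Suc n)))\<^sup>2) \<le> (X w)\<^sup>2" for n
      using abs_scaled_sin_le by (intro always_eventually allI) (metis abs_le_square_iff norm_power real_norm_def power2_abs)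
    show "AE w in M. (\<lambda>n. (real (Suc n) * sin (X w / real (Suc n)))\<^sup>2) \<longlonglongrightarrow> (X w)\<^sup>2"
      by (intro always_eventually allI tendsto_power scaled_sin_tendsto)
    show "(\<lambda>w. (real (Suc n) * sin (X w / real (Suc n)))\<^sup>2) \<in> borel_measurable M" for n
      by measurable
  qed (use X in auto)
  have cos: "(LINT w|M. (real (Suc n) * sin (X w / real (Suc n)))\<^sup>2)
      = (real (Suc n))\<^sup>2 / 2 * (measure M (space M) - (LINT w|M. cos (2 / real (Suc n) * X w)))"
    if [measurable]: "X \<in> borel_measurable M" for X n
  proof -
    have *: "(real (Suc n) * sin (X w / real (Suc n)))\<^sup>2
        = (real (Suc n))\<^sup>2 / 2 * (1 - cos (2 / real (Suc n) * X w))" for w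
      using cos_double_sin[of "X w / real (Suc n)"] by (simp add: power_mult_distrib)
    have "integrable M (\<lambda>w. cos (2 / real (Suc n) * X w))"
      by (rule integrable_const_bound[where B = 1]) auto
    then have "(LINT w|M. 1 - cos (2 / real (Suc n) * X w))
        = measure M (space M) - (LINT w|M. cos (2 / real (Suc n) * X w))"
      by (subst Bochner_Integration.integral_diff) auto
    then show ?thesis
      unfolding * integral_mult_right_zero by simp
  qed
  show ?thesis
    using lim[OF X] lim[OF Y] LIMSEQ_unique unfolding cos[OF X(1)] cos[OF Y(1)] eq by blast
qed

text \<open>The positive and negative parts of \<open>Z\<close>, normalised, are densities of two probability measures
  under which \<open>Y\<close> has the same characteristic function.\<close>

lemma integral_indicator_eq_zero_if_fourier_real:
  fixes Z :: "'w \<Rightarrow> real"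
  assumes Z: "integrable M Z" and Y[measurable]: "Y \<in> borel_measurable M"
    and eq: "\<And>t. (CLINT w|M. Z w * iexp (t * Y w)) = 0"
    and B[measurable]: "B \<in> sets borel"
  shows "(LINT w|M. Z w * indicator B (Y w)) = 0"
proof -
  have Zm[measurable]: "Z \<in> borel_measurable M" using Z by auto
  define P where "P s w = max 0 (s * Z w)" for s w
  have Pm[measurable]: "P s \<in> borel_measurable M" for s
    unfolding P_def by measurable
  have Pi: "integrable M (P s)" for s
    unfolding P_def by (intro Bochner_Integration.integrable_max) (use Z in auto)
  have Pnn: "0 \<le> P s w" for s w by (simp add: P_def)
  have ZP: "Z w = P 1 w - P (-1) w" for w by (simp add: P_def max_def)
  have Pb: "integrable M (\<lambda>w. P s w *\<^sub>R f w)" if "f \<in> borel_measurable M" "\<And>w. norm (f w) \<le> 1"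
    for f :: "'w \<Rightarrow> 'b::{banach, second_countable_topology}" and s
    using that Pnn by (intro Bochner_Integration.integrable_bound[OF Pi[of s]])
      (auto intro!: mult_left_le)
  define c where "c s = (LINT w|M. P s w)" for s
  \<comment> \<open>Frequency zero shows that both parts of \<open>Z\<close> have the same mass, so
    \<open>c 1\<close> normalises both.\<close>
  have "(CLINT w|M. complex_of_real (Z w)) = 0"
    using eq[of 0] by simp
  then have "(LINT w|M. Z w) = 0" by (simp add: integral_complex_of_real)
  then have c_eq: "c 1 = c (-1)"
    unfolding c_def ZP[abs_def] using Pi by simp
  show ?thesis
  proof (cases "c 1 = 0")
    \<comment> \<open>With zero mass there is nothing to normalise, but then \<open>Z\<close>
      vanishes almost everywhere.\<close>
    case True
    then have "AE w in M. P 1 w = 0" "AE w in M. P (-1) w = 0"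
      using integral_nonneg_eq_0_iff_AE[OF Pi[of 1]] integral_nonneg_eq_0_iff_AE[OF Pi[of "-1"]] Pnn c_eq
      unfolding c_def by simp_all
    then have "AE w in M. Z w = 0"
      by eventually_elim (simp add: ZP)
    then have "(LINT w|M. Z w * indicator B (Y w)) = (LINT w|M. 0)"
      by (intro integral_cong_AE) (auto elim!: eventually_mono)
    then show ?thesis by simp
  next
    case False
    then have c: "c 1 > 0"
      using Bochner_Integration.integral_nonneg[of M "P 1"] Pnn unfolding c_def by (simp add: order_less_le)
    define N where "N s = density M (\<lambda>w. ennreal (P s w / c 1))" for s
    define D where "D s = distr (N s) borel Y" for s
    have int: "integral\<^sup>L (D s) f = (LINT w|M. P s w *\<^sub>R f (Y w)) /\<^sub>R c 1"
      if [measurable]: "f \<in> borel_measurable borel" for f :: "real \<Rightarrow> 'b::{banach, second_countable_topology}" and s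
    proof -
      have "integral\<^sup>L (D s) f = integral\<^sup>L (N s) (\<lambda>w. f (Y w))"
        unfolding D_def by (rule integral_distr) (auto simp: N_def)
      also have "\<dots> = (LINT w|M. (P s w / c 1) *\<^sub>R f (Y w))"
        unfolding N_def using Pnn c by (intro integral_density) auto
      also have "\<dots> = (LINT w|M. inverse (c 1) *\<^sub>R (P s w *\<^sub>R f (Y w)))"
        by (simp add: field_simps)
      also have "\<dots> = (LINT w|M. P s w *\<^sub>R f (Y w)) /\<^sub>R c 1"
        by (rule integral_scaleR_right)
      finally show ?thesis .
    qed
    have D: "real_distribution (D s)" if "s \<in> {1, -1}" for s
    proof -
      have "emeasure (N s) (space (N s)) = (\<integral>\<^sup>+w. ennreal (P s w / c 1) \<partial>M)"
        unfolding N_def by (subst emeasure_density) (auto intro!: nn_integral_cong)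
      also have "\<dots> = ennreal (LINT w|M. P s w / c 1)"
        using Pnn c Pi by (intro nn_integral_eq_integral) auto
      also have "(LINT w|M. P s w / c 1) = 1"
        using that c c_eq by (auto simp: c_def)
      finally interpret prob_space "N s"
        by (intro prob_spaceI) simp
      show ?thesis
        unfolding D_def by (rule real_distribution_distr) (simp add: N_def)
    qed
    have "char (D 1) = char (D (-1))"
    proof
      fix t
      have e: "(\<lambda>w. iexp (t * Y w)) \<in> borel_measurable M" by measurable
      have "(CLINT w|M. Z w * iexp (t * Y w))
          = (CLINT w|M. P 1 w *\<^sub>R iexp (t * Y w) - P (-1) w *\<^sub>R iexp (t * Y w))"
        by (simp add: ZP scaleR_conv_of_real algebra_simps)
      also have "\<dots> = (CLINT w|M. P 1 w *\<^sub>R iexp (t * Y w)) - (CLINT w|M. P (-1) w *\<^sub>R iexp (t * Y w))"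
        using e by (intro Bochner_Integration.integral_diff Pb) auto
      finally show "char (D 1) t = char (D (-1)) t"
        unfolding char_def using eq[of t] by (simp add: int)
    qed
    then have "D 1 = D (-1)"
      using D by (intro Levy_uniqueness) auto
    then have "(LINT w|M. P 1 w *\<^sub>R indicat_real B (Y w)) /\<^sub>R c 1 = (LINT w|M. P (-1) w *\<^sub>R indicat_real B (Y w)) /\<^sub>R c 1"
      using int[of "indicat_real B" 1] int[of "indicat_real B" "-1"] by simp
    then have "(LINT w|M. P 1 w *\<^sub>R indicat_real B (Y w)) = (LINT w|M. P (-1) w *\<^sub>R indicat_real B (Y w))"
      using c by simp
    moreover have "(LINT w|M. P 1 w *\<^sub>R indicat_real B (Y w) - P (-1) w *\<^sub>R indicat_real B (Y w))
       = (LINT w|M. P 1 w *\<^sub>R indicat_real B (Y w)) - (LINT w|M. P (-1) w *\<^sub>R indicat_real B (Y w))"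
      by (intro Bochner_Integration.integral_diff Pb) (auto simp: indicator_def)
    ultimately show ?thesis
      by (simp add: ZP left_diff_distrib)
  qed
qed

text \<open>Conjugating the hypothesis at frequency \<open>- t\<close> gives it for
  \<open>cnj Z\<close>, hence for the real and imaginary parts of \<open>Z\<close>, to which the
  real case applies.\<close>

lemma integral_indicator_eq_zero_if_fourier:
  fixes Z :: "'w \<Rightarrow> complex"
  assumes Z: "integrable M Z" and Y[measurable]: "Y \<in> borel_measurable M"
    and eq: "\<And>t. (CLINT w|M. Z w * iexp (t * Y w)) = 0"
    and B[measurable]: "B \<in> sets borel"
  shows "(CLINT w|M. Z w * indicator B (Y w)) = 0"
proof -
  have [measurable]: "Z \<in> borel_measurable M" using Z by auto
  have i: "integrable M (\<lambda>w. Z w * f w)" if "f \<in> borel_measurable M" "\<And>w. norm (f w) \<le> 1" for f :: "'w \<Rightarrow> complex"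
    using that by (intro Bochner_Integration.integrable_bound[OF Z]) (auto simp: norm_mult intro!: mult_left_le)
  have i': "integrable M (\<lambda>w. cnj (Z w) * f w)" if "f \<in> borel_measurable M" "\<And>w. norm (f w) \<le> 1" for f :: "'w \<Rightarrow> complex"
    using that Z by (intro Bochner_Integration.integrable_bound[OF Z])
      (auto simp: norm_mult intro!: mult_left_le borel_measurable_times borel_measurable_integrable[OF integrable_cnj])
  have e: "(\<lambda>w. iexp (t * Y w)) \<in> borel_measurable M" for t by measurable
  have eq': "(CLINT w|M. cnj (Z w) * iexp (t * Y w)) = 0" for t
  proof -
    have "(CLINT w|M. cnj (Z w) * iexp (t * Y w)) = (CLINT w|M. cnj (Z w * iexp (- t * Y w)))"
      by (intro Bochner_Integration.integral_cong) (auto simp: exp_cnj)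
    also have "\<dots> = 0" using eq[of "- t"] by (simp only: Bochner_Integration.integral_cnj complex_cnj_zero)
    finally show ?thesis .
  qed
  have "(LINT w|M. Re (Z w) * indicator B (Y w)) = 0"
  proof (rule integral_indicator_eq_zero_if_fourier_real[OF _ Y _ B])
    fix t
    have "(CLINT w|M. Re (Z w) * iexp (t * Y w)) =
       (CLINT w|M. (Z w * iexp (t * Y w) + cnj (Z w) * iexp (t * Y w)) / 2)"
      by (intro Bochner_Integration.integral_cong) (auto simp: complex_add_cnj simp flip: distrib_right)
    also have "\<dots> = 0"
      using eq eq' i[OF e] i'[OF e] by simp
    finally show "(CLINT w|M. Re (Z w) * iexp (t * Y w)) = 0" .
  qed (use Z in auto)
  moreover have "(LINT w|M. Im (Z w) * indicator B (Y w)) = 0"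
  proof (rule integral_indicator_eq_zero_if_fourier_real[OF _ Y _ B])
    fix t
    have "(CLINT w|M. Im (Z w) * iexp (t * Y w)) =
       (CLINT w|M. (Z w * iexp (t * Y w) - cnj (Z w) * iexp (t * Y w)) / (2 * \<i>))"
      by (intro Bochner_Integration.integral_cong) (auto simp: complex_diff_cnj field_simps simp flip: left_diff_distrib)
    also have "\<dots> = 0"
      using eq eq' i[OF e] i'[OF e] by simp
    finally show "(CLINT w|M. Im (Z w) * iexp (t * Y w)) = 0" .
  qed (use Z in auto)
  moreover have "integrable M (\<lambda>w. Z w * indicator B (Y w))"
    by (intro i) (auto simp: indicator_def)
  then have "Re (CLINT w|M. Z w * indicator B (Y w)) = (LINT w|M. Re (Z w) * indicator B (Y w))"
    "Im (CLINT w|M. Z w * indicator B (Y w)) = (LINT w|M. Im (Z w) * indicator B (Y w))"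
    by (auto simp flip: integral_Re integral_Im intro!: Bochner_Integration.integral_cong split: split_indicator)
  ultimately show ?thesis
    by (simp add: complex_eq_iff)
qed

text \<open>Complex-valued \<open>Z\<close> lets the one-dimensional uniqueness theorem be applied to one coordinate at a
  time, the exponentials of the remaining coordinates being absorbed into \<open>Z\<close>.\<close>

lemma integral_prod_indicator_eq_zero_if_fourier:
  fixes Z :: "'w \<Rightarrow> complex" and Y :: "'i \<Rightarrow> 'w \<Rightarrow> real"
  assumes "finite L" and "integrable M Z" and "\<And>l. l \<in> L \<Longrightarrow> Y l \<in> borel_measurable M"
    and "\<And>l. l \<in> L \<Longrightarrow> B l \<in> sets borel"
    and "\<And>t. (CLINT w|M. Z w * iexp (\<Sum>l\<in>L. t l * Y l w)) = 0"
  shows "(CLINT w|M. Z w * (\<Prod>l\<in>L. indicator (B l) (Y l w))) = 0"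
  using assms
proof (induction L arbitrary: Z rule: finite_induct)
  case empty
  then show ?case by simp
next
  case (insert a L)
  note Z = insert.prems(1)
  have [measurable]: "Z \<in> borel_measurable M" "Y a \<in> borel_measurable M" "B a \<in> sets borel"
    and Ym[measurable]: "\<And>l. l \<in> L \<Longrightarrow> Y l \<in> borel_measurable M"
    using insert.prems by auto
  have i: "integrable M (\<lambda>w. Z w * f w)" if "f \<in> borel_measurable M" "\<And>w. norm (f w) \<le> 1" for f :: "'w \<Rightarrow> complex"
    using that by (intro Bochner_Integration.integrable_bound[OF Z]) (auto simp: norm_mult intro!: mult_left_le)
  have "(CLINT w|M. (Z w * indicator (B a) (Y a w)) * (\<Prod>l\<in>L. indicator (B l) (Y l w))) = 0"
  proof (rule insert.IH)
    show "integrable M (\<lambda>w. Z w * indicator (B a) (Y a w))"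
      by (intro i) (auto simp: indicator_def)
    fix t :: "'i \<Rightarrow> real"
    have "(CLINT w|M. (Z w * iexp (\<Sum>l\<in>L. t l * Y l w)) * indicator (B a) (Y a w)) = 0"
    proof (rule integral_indicator_eq_zero_if_fourier)
      show "integrable M (\<lambda>w. Z w * iexp (\<Sum>l\<in>L. t l * Y l w))"
        by (intro i) auto
      fix s
      \<comment> \<open>Setting the frequency at \<open>a\<close> to \<open>s\<close> splits the
        joint exponential into the factor absorbed into \<open>Z\<close> and the one-dimensional
        \<open>iexp (s * Y a w)\<close>.\<close>
      have "(\<Sum>l\<in>insert a L. (t(a := s)) l * Y l w) = s * Y a w + (\<Sum>l\<in>L. t l * Y l w)" for w
        using insert.hyps by (auto intro!: sum.cong)
      then show "(CLINT w|M. Z w * iexp (\<Sum>l\<in>L. t l * Y l w) * iexp (s * Y a w)) = 0"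
        using insert.prems(4)[of "t(a := s)"] by (simp add: distrib_left exp_add mult_ac)
    qed auto
    then show "(CLINT w|M. Z w * indicator (B a) (Y a w) * iexp (\<Sum>l\<in>L. t l * Y l w)) = 0"
      by (simp add: mult_ac)
  qed (use insert.prems in auto)
  then show ?case
    using insert.hyps by (simp add: mult_ac)
qed

subsection \<open>Elliptical random elements\<close>

text \<open>The generator \<open>\<phi>\<close> may depend on the operator into \<open>\<real>\<^sup>d\<close>; the case \<open>d = 2\<close> provides a common one
  for any two directions.\<close>

lemma elliptical_with_char_fun:
  fixes V :: "'w \<Rightarrow> 'h::{real_inner, banach, second_countable_topology}"
  assumes "elliptical_with M V m G"
  obtains \<phi> where "\<And>s t. (CLINT w|M. iexp ((s *\<^sub>R u + t *\<^sub>R v) \<bullet> (V w - m)))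
      = complex_of_real (\<phi> (G (s *\<^sub>R u + t *\<^sub>R v) \<bullet> (s *\<^sub>R u + t *\<^sub>R v)))"
proof -
  have G: "linear G"
    using assms unfolding elliptical_with_def compact_operator_def by (simp add: bounded_linear.linear)
  \<comment> \<open>The operator into the plane with coordinate functionals \<open>u\<close> and
    \<open>v\<close>; its adjoint sends \<open>s\<close> to
    \<open>s 0 *\<^sub>R u + s 1 *\<^sub>R v\<close>.\<close>
  define A where "A x i = (if i = 0 then u \<bullet> x else v \<bullet> x)" for x :: 'h and i :: nat
  have "bounded_linear (\<lambda>x. A x i)" for i
    by (cases "i = 0") (simp_all add: A_def bounded_linear_inner_right)
  then have "bounded_linear_Rd 2 A"
    by (simp add: bounded_linear_Rd_def)
  then have ell: "elliptical_vec M 2 (\<lambda>w. A (V w)) (A m) (sandwich_matrix 2 A G)"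
    using assms unfolding elliptical_with_def by blast
  have lt2: "{..<2::nat} = {0, 1}"
    by auto
  have adj: "adjoint_Rd 2 A = (\<lambda>s. s 0 *\<^sub>R u + s 1 *\<^sub>R v)"
    by (rule adjoint_Rd_unique) (simp add: A_def lt2 inner_add_right inner_commute mult.commute)
  obtain \<phi> where \<phi>: "\<And>t. (CLINT w|M. iexp (\<Sum>i<2. t i * (A (V w) i - A m i)))
      = complex_of_real (\<phi> (\<Sum>i<2. \<Sum>j<2. t i * sandwich_matrix 2 A G i j * t j))"
    using ell unfolding elliptical_vec_def by blast
  show thesis
  proof (rule that[of \<phi>])
    fix s t :: real
    define r where "r i = (if i = 0 then s else t)" for i :: nat
    have "(\<Sum>i<2. r i * (A x i - A m i)) = (s *\<^sub>R u + t *\<^sub>R v) \<bullet> (x - m)" for x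
      by (simp add: A_def r_def lt2 inner_add_left inner_diff_right algebra_simps)
    moreover have "(\<Sum>i<2. \<Sum>j<2. r i * sandwich_matrix 2 A G i j * r j)
        = G (s *\<^sub>R u + t *\<^sub>R v) \<bullet> (s *\<^sub>R u + t *\<^sub>R v)"
      by (simp add: A_def r_def lt2 sandwich_matrix_def adj linear_add[OF G] linear_scale[OF G]
          inner_add inner_commute algebra_simps)
    ultimately show "(CLINT w|M. iexp ((s *\<^sub>R u + t *\<^sub>R v) \<bullet> (V w - m)))
      = complex_of_real (\<phi> (G (s *\<^sub>R u + t *\<^sub>R v) \<bullet> (s *\<^sub>R u + t *\<^sub>R v)))"
      using \<phi>[of r] by simp
  qed
qed

lemma (in prob_space) integral_cos_sin_eq_iexp:
  assumes [measurable]: "X \<in> borel_measurable M"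
  shows "(LINT w|M. cos (X w)) = Re (CLINT w|M. iexp (X w))"
    and "(LINT w|M. sin (X w)) = Im (CLINT w|M. iexp (X w))"
proof -
  have "integrable M (\<lambda>w. iexp (X w))"
    by (rule integrable_const_bound[where B = 1]) auto
  then show "(LINT w|M. cos (X w)) = Re (CLINT w|M. iexp (X w))"
    "(LINT w|M. sin (X w)) = Im (CLINT w|M. iexp (X w))"
    by (simp_all add: Re_exp Im_exp flip: integral_Re integral_Im)
qed

text \<open>The characteristic function of \<open>m \<bullet> (V w - m)\<close> is real, so all its
  sine integrals vanish and with them its mean, which equals
  \<open>- (m \<bullet> m)\<close>.\<close>

lemma elliptical_with_centered:
  fixes V :: "'w \<Rightarrow> 'h::{real_inner, banach, second_countable_topology}"
  assumes "prob_space M" and V: "integrable M V" "integral\<^sup>L M V = 0" and ell: "elliptical_with M V m G"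
  shows "m = 0"
proof -
  interpret prob_space M by fact
  have [measurable]: "V \<in> borel_measurable M"
    using V by auto
  define X where "X w = m \<bullet> (V w - m)" for w
  have X: "integrable M X"
    unfolding X_def using V by auto
  obtain \<phi> where \<phi>: "\<And>s t. (CLINT w|M. iexp ((s *\<^sub>R m + t *\<^sub>R m) \<bullet> (V w - m)))
      = complex_of_real (\<phi> (G (s *\<^sub>R m + t *\<^sub>R m) \<bullet> (s *\<^sub>R m + t *\<^sub>R m)))"
    using elliptical_with_char_fun[OF ell] by metis
  have sin0: "(LINT w|M. sin (s * X w)) = 0" for s
    using \<phi>[of s 0] X by (subst integral_cos_sin_eq_iexp) (auto simp: X_def)
  have "(CLINT w|M. (\<lambda>_. 1) w * complex_of_real (X w)) = 0"
    by (rule integral_mult_eq_zero_if_sin[OF X]) (simp_all only: mult_1 integral_complex_of_real sin0, auto)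
  then have "(LINT w|M. X w) = 0"
    by simp
  moreover have "(LINT w|M. X w) = - (m \<bullet> m)"
    unfolding X_def using V by (simp add: prob_space)
  ultimately show ?thesis
    by simp
qed

text \<open>The second moment of \<open>\<langle>u, V\<rangle>\<close> depends on \<open>\<langle>G u, u\<rangle>\<close> only, and both are quadratic in \<open>u\<close>.\<close>

lemma elliptical_with_covariance_operator_proportional:
  fixes V :: "'w \<Rightarrow> 'h::{real_inner, banach, second_countable_topology}"
  assumes "prob_space M" and V: "integrable M V" "integral\<^sup>L M V = 0" and ell: "elliptical_with M V 0 G"
    and cov: "is_covariance_operator M V \<Gamma>" and lin: "linear \<Gamma>"
  shows "\<exists>c. \<forall>x. \<Gamma> x = c *\<^sub>R G x"
proof -
  interpret prob_space M by fact
  have [measurable]: "V \<in> borel_measurable M"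
    using V by auto
  have G: "linear G" "\<And>x y. G x \<bullet> y = x \<bullet> G y" "\<And>x. 0 \<le> G x \<bullet> x"
    using ell unfolding elliptical_with_def compact_operator_def self_adjoint_def psd_operator_def
    by (auto simp: bounded_linear.linear)
  have cov_eq: "\<Gamma> u \<bullet> v = (LINT w|M. (u \<bullet> V w) * (v \<bullet> V w))" for u v
    using cov V unfolding is_covariance_operator_def covariance_def by simp
  have sq: "integrable M (\<lambda>w. (u \<bullet> V w)\<^sup>2)" for u
  proof (rule Bochner_Integration.integrable_bound)
    show "integrable M (\<lambda>w. (norm u)\<^sup>2 * (norm (V w))\<^sup>2)"
      using cov unfolding is_covariance_operator_def by simp
    show "AE w in M. norm ((u \<bullet> V w)\<^sup>2) \<le> norm ((norm u)\<^sup>2 * (norm (V w))\<^sup>2)"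
      by (intro always_eventually allI)
        (simp add: Cauchy_Schwarz_ineq power2_norm_eq_inner)
  qed simp
  have eq: "\<Gamma> u \<bullet> u = \<Gamma> v \<bullet> v" if uv: "G u \<bullet> u = G v \<bullet> v" for u v
  proof -
    obtain \<phi> where \<phi>: "\<And>s t. (CLINT w|M. iexp ((s *\<^sub>R u + t *\<^sub>R v) \<bullet> (V w - 0)))
        = complex_of_real (\<phi> (G (s *\<^sub>R u + t *\<^sub>R v) \<bullet> (s *\<^sub>R u + t *\<^sub>R v)))"
      using elliptical_with_char_fun[OF ell] by metis
    have "(LINT w|M. (u \<bullet> V w)\<^sup>2) = (LINT w|M. (v \<bullet> V w)\<^sup>2)"
    proof (rule second_moment_eq_if_cos)
      fix s
      have "(CLINT w|M. iexp (s * (u \<bullet> V w))) = (CLINT w|M. iexp (s * (v \<bullet> V w)))"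
        \<comment> \<open>The two choices isolate the directions \<open>u\<close> and
          \<open>v\<close> under one generator, evaluated at equal arguments.\<close>
        using \<phi>[of s 0] \<phi>[of 0 s] uv by (simp add: linear_scale[OF G(1)])
      then show "(LINT w|M. cos (s * (u \<bullet> V w))) = (LINT w|M. cos (s * (v \<bullet> V w)))"
        by (simp add: integral_cos_sin_eq_iexp)
    qed (use sq in \<open>auto intro: finite_measure_axioms\<close>)
    then show ?thesis
      by (simp add: cov_eq power2_eq_square)
  qed
  have "\<exists>c. \<forall>u. \<Gamma> u \<bullet> u = c * (G u \<bullet> u)"
  proof (cases "\<exists>u. G u \<bullet> u \<noteq> 0")
    case True
    then obtain u0 where u0: "G u0 \<bullet> u0 > 0"
      using G(3) by (metis order_less_le)
    have "\<Gamma> u \<bullet> u = (\<Gamma> u0 \<bullet> u0 / (G u0 \<bullet> u0)) * (G u \<bullet> u)" for u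
    proof -
      \<comment> \<open>The scaling for which \<open>a *\<^sub>R u0\<close> and \<open>u\<close>
        have the same value of the quadratic form of \<open>G\<close>.\<close>
      define a where "a = sqrt (G u \<bullet> u / (G u0 \<bullet> u0))"
      have a: "a * a = G u \<bullet> u / (G u0 \<bullet> u0)"
        unfolding a_def using u0 G(3) by simp
      have "G (a *\<^sub>R u0) \<bullet> (a *\<^sub>R u0) = (a * a) * (G u0 \<bullet> u0)"
        by (simp add: linear_scale[OF G(1)])
      then have "\<Gamma> u \<bullet> u = \<Gamma> (a *\<^sub>R u0) \<bullet> (a *\<^sub>R u0)"
        using u0 a by (intro eq) simp
      also have "\<dots> = (a * a) * (\<Gamma> u0 \<bullet> u0)"
        by (simp add: linear_scale[OF lin])
      finally show ?thesis
        using a by simp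
    qed
    then show ?thesis by blast
  next
    case False
    \<comment> \<open>If the form of \<open>G\<close> is zero, every \<open>u\<close> can be
      compared with the zero vector.\<close>
    then have "\<Gamma> u \<bullet> u = 0" for u
      using eq[of u 0] by simp
    then show ?thesis by auto
  qed
  then obtain c where c: "\<And>u. \<Gamma> u \<bullet> u = c * (G u \<bullet> u)"
    by blast
  \<comment> \<open>Polarisation: both forms are symmetric, so their diagonals determine
    them.\<close>
  have "\<Gamma> x \<bullet> y = c *\<^sub>R G x \<bullet> y" for x y
  proof -
    have "\<Gamma> y \<bullet> x = \<Gamma> x \<bullet> y" "G y \<bullet> x = G x \<bullet> y"
      using cov_eq[of x y] cov_eq[of y x] G(2) by (auto simp: mult.commute inner_commute)
    then show ?thesis
      using c[of "x + y"] c[of x] c[of y]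
      by (simp add: linear_add[OF lin] linear_add[OF G(1)] inner_add algebra_simps)
  qed
  then have "\<Gamma> x = c *\<^sub>R G x" for x
    using vector_eq_rdot by blast
  then show ?thesis by blast
qed

text \<open>Orthogonality removes the cross terms from the quadratic form at
  \<open>s *\<^sub>R u + v\<close>, so the joint characteristic function is even in
  \<open>s\<close>. Its odd part is the integral of \<open>iexp (v \<bullet> V w)\<close> against
  \<open>sin (s * (u \<bullet> V w))\<close>, up to a constant factor.\<close>

lemma elliptical_with_orthogonal_fourier:
  fixes V :: "'w \<Rightarrow> 'h::{real_inner, banach, second_countable_topology}"
  assumes "prob_space M" and V: "integrable M V" and ell: "elliptical_with M V 0 G"
    and uv: "u \<bullet> G v = 0"
  shows "(CLINT w|M. complex_of_real (u \<bullet> V w) * iexp (v \<bullet> V w)) = 0"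
proof -
  interpret prob_space M by fact
  have [measurable]: "V \<in> borel_measurable M"
    using V by auto
  have euler: "iexp (a + b) - iexp (b - a) = 2 * \<i> * (iexp b * complex_of_real (sin a))" for a b
    by (simp add: complex_eq_iff Re_exp Im_exp cos_add sin_add cos_diff sin_diff)
  have G: "linear G" "\<And>x y. G x \<bullet> y = x \<bullet> G y"
    using ell unfolding elliptical_with_def compact_operator_def self_adjoint_def
    by (auto simp: bounded_linear.linear)
  obtain \<phi> where \<phi>: "\<And>s t. (CLINT w|M. iexp ((s *\<^sub>R u + t *\<^sub>R v) \<bullet> (V w - 0)))
      = complex_of_real (\<phi> (G (s *\<^sub>R u + t *\<^sub>R v) \<bullet> (s *\<^sub>R u + t *\<^sub>R v)))"
    using elliptical_with_char_fun[OF ell] by metis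
  have "(CLINT w|M. iexp (v \<bullet> V w) * (u \<bullet> V w)) = 0"
  proof (rule integral_mult_eq_zero_if_sin)
    fix s
    have int: "integrable M (\<lambda>w. iexp ((r *\<^sub>R u + 1 *\<^sub>R v) \<bullet> (V w - 0)))" for r
      by (rule integrable_const_bound[where B = 1]) auto
    have "G v \<bullet> u = 0" "G u \<bullet> v = 0"
      using uv G(2) by (metis inner_commute)+
    then have "G (s *\<^sub>R u + 1 *\<^sub>R v) \<bullet> (s *\<^sub>R u + 1 *\<^sub>R v) = G (- s *\<^sub>R u + 1 *\<^sub>R v) \<bullet> (- s *\<^sub>R u + 1 *\<^sub>R v)"
      by (simp add: linear_add[OF G(1)] linear_diff[OF G(1)] linear_neg[OF G(1)] linear_scale[OF G(1)] inner_add inner_diff)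
    then have "(CLINT w|M. iexp ((s *\<^sub>R u + 1 *\<^sub>R v) \<bullet> (V w - 0))) = (CLINT w|M. iexp ((- s *\<^sub>R u + 1 *\<^sub>R v) \<bullet> (V w - 0)))"
      unfolding \<phi> by simp
    then have "(CLINT w|M. (iexp ((s *\<^sub>R u + 1 *\<^sub>R v) \<bullet> (V w - 0)) - iexp ((- s *\<^sub>R u + 1 *\<^sub>R v) \<bullet> (V w - 0))) / (2 * \<i>)) = 0"
      using Bochner_Integration.integral_diff[OF int[of s] int[of "- s"]]
      unfolding integral_divide_zero by simp
    moreover have "iexp (v \<bullet> V w) * complex_of_real (sin (s * (u \<bullet> V w)))
        = (iexp ((s *\<^sub>R u + 1 *\<^sub>R v) \<bullet> (V w - 0)) - iexp ((- s *\<^sub>R u + 1 *\<^sub>R v) \<bullet> (V w - 0))) / (2 * \<i>)" for w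
      using euler[of "s * (u \<bullet> V w)" "v \<bullet> V w"] by (simp add: inner_add_left inner_diff_left)
    ultimately show "(CLINT w|M. iexp (v \<bullet> V w) * complex_of_real (sin (s * (u \<bullet> V w)))) = 0"
      by simp
  qed (use V in auto)
  then show ?thesis
    by (simp add: mult.commute)
qed

section \<open>Domains of attraction and self-consistent points\<close>

text \<open>The quadratic term in \<open>x\<close> cancels when squared distances to two points are
  compared, which leaves an affine condition.\<close>

lemma attraction_domain_eq_halfspaces:
  fixes y :: "nat \<Rightarrow> 'h::real_inner"
  obtains B where "\<And>l. B l \<in> sets (borel :: real measure)"
    "attraction_domain k y j = {x. \<forall>l\<in>{1..k}. (y l - y j) \<bullet> x \<in> B l}"
proof -
  define r where "r l = ((norm (y l))\<^sup>2 - (norm (y j))\<^sup>2) / 2" for l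
  \<comment> \<open>Ties go to the lower index, so the half-line is open exactly for
    \<open>l < j\<close>. For \<open>l = j\<close> the condition reads
    \<open>0 \<le> 0\<close>.\<close>
  define B where "B l = (if l < j then {..<r l} else {..r l})" for l
  have sq: "(norm (x - y l))\<^sup>2 - (norm (x - y j))\<^sup>2 = 2 * (r l - (y l - y j) \<bullet> x)" for x l
    by (simp add: r_def power2_norm_eq_inner inner_diff inner_commute field_simps)
  have pw: "norm a \<le> norm b \<longleftrightarrow> (norm a)\<^sup>2 \<le> (norm b)\<^sup>2" for a b :: 'h
    by simp
  have le: "norm (x - y j) \<le> norm (x - y l) \<longleftrightarrow> (y l - y j) \<bullet> x \<le> r l" for x l
    using sq[where x = x and l = l] pw[of "x - y j" "x - y l"] by argo
  have lt: "norm (x - y j) < norm (x - y l) \<longleftrightarrow> (y l - y j) \<bullet> x < r l" for x l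
    using sq[where x = x and l = l] pw[of "x - y l" "x - y j"] by argo
  have "attraction_domain k y j = {x. \<forall>l\<in>{1..k}. (y l - y j) \<bullet> x \<in> B l}"
    unfolding attraction_domain_def B_def le lt by force
  then show thesis
    by (rule that[rotated]) (auto simp: B_def)
qed

text \<open>The vector \<open>y j\<close> is the integral of \<open>V\<close> over the event
  \<open>E\<close>, divided by \<open>prob E\<close>. The event only involves the directions
  \<open>y l - y j\<close>, so all test frequencies stay in the span, where the Fourier integral of
  \<open>u \<bullet> V w\<close> vanishes.\<close>

lemma self_consistent_orthogonal:
  fixes V :: "'w \<Rightarrow> 'h::{real_inner, banach, second_countable_topology}"
  assumes "prob_space M" and V: "integrable M V" and ell: "elliptical_with M V 0 G"
    and sc: "self_consistent M V k y" and j: "j \<in> {1..k}"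
    and u: "\<And>v. v \<in> span (y ` {1..k}) \<Longrightarrow> u \<bullet> G v = 0"
  shows "u \<bullet> y j = 0"
proof -
  interpret prob_space M by fact
  have [measurable]: "V \<in> borel_measurable M"
    using V by auto
  obtain B where B: "\<And>l. B l \<in> sets (borel :: real measure)"
    and D: "attraction_domain k y j = {x. \<forall>l\<in>{1..k}. (y l - y j) \<bullet> x \<in> B l}"
    using attraction_domain_eq_halfspaces by blast
  define E where "E = {w \<in> space M. V w \<in> attraction_domain k y j}"
  have E_eq: "E = {w \<in> space M. \<forall>l\<in>{1..k}. (y l - y j) \<bullet> V w \<in> B l}"
    unfolding E_def D by simp
  note B[measurable]
  have [measurable]: "E \<in> sets M"
    unfolding E_eq by measurable
  have E: "prob E > 0" "integral\<^sup>L (uniform_measure M E) V = y j"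
    using sc j unfolding self_consistent_def Let_def E_def by auto
  have Y: "(CLINT w|M. complex_of_real (u \<bullet> V w) * (\<Prod>l\<in>{1..k}. indicator (B l) ((y l - y j) \<bullet> V w))) = 0"
  proof (rule integral_prod_indicator_eq_zero_if_fourier)
    fix t :: "nat \<Rightarrow> real"
    define v where "v = (\<Sum>l\<in>{1..k}. t l *\<^sub>R (y l - y j))"
    have "v \<in> span (y ` {1..k})"
      unfolding v_def using j by (intro span_sum span_scale span_diff span_base) auto
    moreover have "(\<Sum>l\<in>{1..k}. t l * ((y l - y j) \<bullet> V w)) = v \<bullet> V w" for w
      unfolding v_def by (simp add: inner_sum_left)
    ultimately show "(CLINT w|M. complex_of_real (u \<bullet> V w) * iexp (\<Sum>l\<in>{1..k}. t l * ((y l - y j) \<bullet> V w))) = 0"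
      using elliptical_with_orthogonal_fourier[OF \<open>prob_space M\<close> V ell u] by simp
  qed (use V B in auto)
  \<comment> \<open>The indicator of an intersection is the product of the indicators.\<close>
  have "complex_of_real (indicator E w * (u \<bullet> V w))
      = complex_of_real (u \<bullet> V w) * (\<Prod>l\<in>{1..k}. indicator (B l) ((y l - y j) \<bullet> V w))"
    if "w \<in> space M" for w
    using that by (auto simp: E_eq indicator_def prod_zero_iff)
  then have "(CLINT w|M. complex_of_real (indicator E w * (u \<bullet> V w)))
      = (CLINT w|M. complex_of_real (u \<bullet> V w) * (\<Prod>l\<in>{1..k}. indicator (B l) ((y l - y j) \<bullet> V w)))"
    by (intro Bochner_Integration.integral_cong refl)
  then have 0: "(LINT w|M. indicator E w * (u \<bullet> V w)) = 0"
    unfolding Y integral_complex_of_real by simp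
  have um: "uniform_measure M E = density M (\<lambda>w. ennreal (indicator E w / prob E))"
    unfolding uniform_measure_def using E(1)
    by (intro density_cong) (auto simp: emeasure_eq_measure divide_ennreal simp flip: ennreal_1 split: split_indicator)
  have "y j = (LINT w|M. (indicator E w / prob E) *\<^sub>R V w)"
    using E(1) unfolding E(2)[symmetric] um by (intro integral_density) auto
  moreover have "integrable M (\<lambda>w. (indicator E w / prob E) *\<^sub>R V w)"
    using integrable_scaleR_right[OF integrable_mult_indicator[OF \<open>E \<in> sets M\<close> V], of "inverse (prob E)"]
    by (simp add: divide_inverse mult.commute)
  ultimately have "u \<bullet> y j = (LINT w|M. u \<bullet> ((indicator E w / prob E) *\<^sub>R V w))"
    by (simp only: integral_inner_right)
  also have "\<dots> = (LINT w|M. indicator E w * (u \<bullet> V w)) / prob E"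
    by simp
  finally show ?thesis
    using 0 by simp
qed

theorem theorem3p2:
  fixes M :: "'w measure"
    and V :: "'w \<Rightarrow> 'h::{real_inner, banach, second_countable_topology}"
    and \<Gamma>\<^sub>V :: "'h \<Rightarrow> 'h"
    and k :: nat
    and y :: "nat \<Rightarrow> 'h"
  assumes "prob_space M"
    and "elliptical M V"
    and "integral\<^sup>L M V = 0"
    and "is_covariance_operator M V \<Gamma>\<^sub>V"
    and "compact_operator \<Gamma>\<^sub>V"
    and "k > 1"
    and "self_consistent M V k y"
  shows "\<exists>S. (\<forall>v\<in>S. eigenvector \<Gamma>\<^sub>V v) \<and> span S = span (y ` {1..k})"
proof -
  interpret prob_space M by fact
  let ?Y = "y ` {1..k}"
  obtain m G where ell: "elliptical_with M V m G"
    using assms(2) unfolding elliptical_def by blast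
  then have [measurable]: "V \<in> borel_measurable M" and G: "bounded_linear G" "self_adjoint G"
    unfolding elliptical_with_def compact_operator_def by auto
  have "integrable M V"
  proof (rule Bochner_Integration.integrable_bound)
    show "integrable M (\<lambda>w. 1 + (norm (V w))\<^sup>2)"
      using assms(4) unfolding is_covariance_operator_def by simp
    \<comment> \<open>Square integrability yields integrability, since
      \<open>2 * norm x \<le> 1 + (norm x)\<^sup>2\<close> and constants are integrable
      here.\<close>
    have "norm x \<le> 1 + (norm x)\<^sup>2" for x :: 'h
      using sum_squares_bound[of "norm x" 1] by (simp add: power2_eq_square) (smt (verit) norm_ge_zero)
    then show "AE w in M. norm (V w) \<le> norm (1 + (norm (V w))\<^sup>2)"
      by (simp add: abs_of_nonneg)
  qed simp
  note V = assms(1) this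
  have ell0: "elliptical_with M V 0 G"
    using ell elliptical_with_centered[OF V assms(3) ell] by simp
  have "linear \<Gamma>\<^sub>V"
    using assms(5) unfolding compact_operator_def by (simp add: bounded_linear.linear)
  then obtain c where c: "\<And>x. \<Gamma>\<^sub>V x = c *\<^sub>R G x"
    using elliptical_with_covariance_operator_proportional[OF V assms(3) ell0 assms(4)] by blast
  have "G ` span ?Y \<subseteq> span ?Y"
  proof (rule image_span_subset_if_orthogonal_complement)
    fix u w assume "\<And>w. w \<in> span ?Y \<Longrightarrow> u \<bullet> G w = 0" "w \<in> ?Y"
    then show "u \<bullet> w = 0"
      using self_consistent_orthogonal[OF V ell0 assms(7)] by blast
  qed (use G in \<open>auto simp: bounded_linear.linear\<close>)
  then have "span {v \<in> span ?Y. eigenvector G v} = span ?Y"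
    using G by (intro span_eigenvectors_eq_invariant_span) auto
  \<comment> \<open>The eigenvalue is multiplied by \<open>c\<close>; this also covers
    \<open>c = 0\<close>.\<close>
  moreover have "eigenvector \<Gamma>\<^sub>V v" if "eigenvector G v" for v
    using that unfolding eigenvector_def c by (metis scaleR_scaleR)
  ultimately show ?thesis
    by (intro exI[of _ "{v \<in> span ?Y. eigenvector G v}"]) auto
qed

end
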